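(* Let $(F,d)$ be a non-empty totally bounded metric space, and for each $q\in\mathbb{N}$ let $P(q)\subseteq F$ be a maximal $(1/q)$-separated set (a choice of abstract rationals), with associated sets $F_t$. Then for all $t\geq 1$ $$\dim_{\mathrm H} F_t \leq \frac{\dim_{\mathrm P}F+1}{t},$$ and, if $F$ is compact, then for all $t\geq 1$ $$\dim_{\mathrm P} F_t \geq \frac{\dim_{\mathrm L}F}{t}.$$
   Context: Let $(F,d)$ be a non-empty totally bounded metric space. A set $A\subseteq F$ is $r$-separated if $d(a,b)\geq r$ for all distinct $a,b\in A$. A choice of abstract rationals in $F$ is a family $P=(P(q))_{q\in\mathbb{N}}$, $\mathbb N=\{1,2,\dots\}$, where each $P(q)\subseteq F$ is a maximal $(1/q)$-separated set, i.e. it is $(1/q)$-separated and no further point of $F$ can be added while keeping it $(1/q)$-separated. Given such a choice and $t>0$, $$F_t=\bigcap_{N}\bigcup_{q>N}\bigcup_{p\in P(q)}B(p,1/q^t),$$ where $B(x,r)$ denotes the closed ball in $F$; that is, $F_t$ is the set of $x\in F$ such that for infinitely many $q$ there is $p\in P(q)$ with $d(p,x)\leq 1/q^t$. $\dim_{\mathrm H}$ denotes Hausdorff dimension. $N_r(X)$ denotes the maximum cardinality of an $r$-separated subset of $X$. The upper box dimension is $\overline{\dim}_{\mathrm B}X=\limsup_{r\to0}\frac{\log N_r(X)}{-\log r}$. The packing dimension is $\dim_{\mathrm P}X=\inf\{\sup_i\overline{\dim}_{\mathrm B}X_i : X=\bigcup_i X_i\}$, the infimum being over countable decompositions. The lower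 dimension $\dim_{\mathrm L}X$ is the supremum of all $s\geq0$ for which there is a constant $C>0$ such that for all $0<r<R\leq|X|$ and all $x\in X$, $N_r(B(x,R)\cap X)\geq C(R/r)^s$, where $|X|$ is the diameter of $X$; if $X$ is a single point then $\dim_{\mathrm L}X=0$ by convention. *)

theory Defs
  imports "HOL-Analysis.Analysis"
begin

text \<open>
  A metric space \<open>(F, d)\<close> is represented by a subset \<open>F\<close> of a type of class
  \<^class>\<open>metric_space\<close>, with the metric induced by \<^const>\<open>dist\<close>. Dimensions are extended reals,
  since they may be infinite. The Hausdorff, upper box, packing and lower dimensions of the empty
  set are all \<open>0\<close>.
\<close>

definition separated :: "real \<Rightarrow> 'a::metric_space set \<Rightarrow> bool"
  where "separated r A \<longleftrightarrow> (\<forall>a\<in>A. \<forall>b\<in>A. a \<noteq> b \<longrightarrow> r \<le> dist a b)"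

definition maximal_separated :: "'a::metric_space set \<Rightarrow> real \<Rightarrow> 'a set \<Rightarrow> bool"
  where "maximal_separated F r A \<longleftrightarrow>
    A \<subseteq> F \<and> separated r A \<and> (\<forall>x\<in>F - A. \<not> separated r (insert x A))"

text \<open>The value of \<open>P\<close> at \<open>0\<close> is irrelevant.\<close>

definition abstract_rationals :: "'a::metric_space set \<Rightarrow> (nat \<Rightarrow> 'a set) \<Rightarrow> bool"
  where "abstract_rationals F P \<longleftrightarrow> (\<forall>q\<ge>1. maximal_separated F (1 / real q) (P q))"

definition approximable :: "'a::metric_space set \<Rightarrow> (nat \<Rightarrow> 'a set) \<Rightarrow> real \<Rightarrow> 'a set"
  where "approximable F P t =
    (\<Inter>N. \<Union>q\<in>{N<..}. \<Union>p\<in>P q. cball p (1 / real q powr t) \<inter> F)"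

text \<open>The value is \<open>\<infinity>\<close> if \<open>X\<close> has arbitrarily large finite \<open>r\<close>-separated subsets.\<close>

definition sep_number :: "real \<Rightarrow> 'a::metric_space set \<Rightarrow> enat"
  where "sep_number r X = (SUP A\<in>{A. A \<subseteq> X \<and> finite A \<and> separated r A}. enat (card A))"

text \<open>Since \<open>ln 0 = 0\<close> in HOL, \<open>log_enat 0 = 0\<close>; this is only relevant to the empty set.\<close>

definition log_enat :: "enat \<Rightarrow> ereal"
  where "log_enat n = (case n of enat k \<Rightarrow> ereal (ln (real k)) | \<infinity> \<Rightarrow> \<infinity>)"

definition upper_box_dim :: "'a::metric_space set \<Rightarrow> ereal"
  where "upper_box_dim X =
    Limsup (at_right 0) (\<lambda>r. log_enat (sep_number r X) / ereal (- ln r))"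

text \<open>Finite decompositions are included, as pieces may be empty or repeated.\<close>

definition packing_dim :: "'a::metric_space set \<Rightarrow> ereal"
  where "packing_dim X =
    (INF Y\<in>{Y :: nat \<Rightarrow> 'a set. (\<Union>i. Y i) = X}. SUP i. upper_box_dim (Y i))"

text \<open>
  The guard \<^term>\<open>bounded X\<close> is there because \<^const>\<open>diameter\<close> is real-valued and
  unspecified on unbounded sets, whose diameter should be \<open>\<infinity>\<close>.
\<close>

definition lower_dim :: "'a::metric_space set \<Rightarrow> ereal"
  where "lower_dim X =
    (if \<exists>a. X \<subseteq> {a} then 0
     else Sup (ereal ` {s. 0 \<le> s \<and>
       (\<exists>C>0. \<forall>r R. 0 < r \<longrightarrow> r < R \<longrightarrow> (bounded X \<longrightarrow> R \<le> diameter X) \<longrightarrow>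
         (\<forall>x\<in>X. ereal (C * (R / r) powr s) \<le> ereal_of_enat (sep_number r (cball x R \<inter> X))))}))"

text \<open>
  \<open>|U|\<^sup>s\<close> with the usual conventions \<open>|{}|\<^sup>s = 0\<close> and \<open>|U|\<^sup>0 = 1\<close> for nonempty \<open>U\<close>
  (in HOL, \<open>0 powr 0 = 0\<close>).
\<close>

definition diameter_powr :: "real \<Rightarrow> 'a::metric_space set \<Rightarrow> real"
  where "diameter_powr s U = (if U = {} then 0 else if s = 0 then 1 else diameter U powr s)"

definition hausdorff_premeasure :: "real \<Rightarrow> real \<Rightarrow> 'a::metric_space set \<Rightarrow> ennreal"
  where "hausdorff_premeasure s \<delta> X =
    (INF U\<in>{U :: nat \<Rightarrow> 'a set. X \<subseteq> (\<Union>i. U i) \<and> (\<forall>i. bounded (U i) \<and> diameter (U i) \<le> \<delta>)}.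
      \<Sum>i. ennreal (diameter_powr s (U i)))"

definition hausdorff_measure :: "real \<Rightarrow> 'a::metric_space set \<Rightarrow> ennreal"
  where "hausdorff_measure s X = (SUP \<delta>\<in>{0<..}. hausdorff_premeasure s \<delta> X)"

definition hausdorff_dim :: "'a::metric_space set \<Rightarrow> ereal"
  where "hausdorff_dim X = Inf (ereal ` {s. 0 \<le> s \<and> hausdorff_measure s X = 0})"

end

theory Submission
  imports Defs "HOL-Real_Asymp.Real_Asymp"
begin

text \<open>
  For the upper bound, decompose \<open>F\<close> into pieces \<open>Y\<close> of upper box dimension less than \<open>s\<close>. If
  \<open>t > 1\<close>, the balls \<open>B(p, q\<^sup>-\<^sup>t)\<close> with \<open>p \<in> P(q)\<close> that meet \<open>Y\<close> do so in points that are
  \<open>1/(2q)\<close>-separated for large \<open>q\<close>, so there are at most \<open>(2q)\<^sup>s\<close> of them, and the sum of the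
  \<open>u\<close>-th powers of the diameters of these covers converges as soon as \<open>tu > s + 1\<close>. For \<open>t = 1\<close>
  the summand \<open>1\<close> leaves room to use maximal \<open>1/q\<close>-separated subsets of \<open>Y\<close> at every scale \<open>q\<close>.

  For the lower bound, \<open>F\<^sub>t\<close> contains a dense \<open>G\<^sub>\<delta>\<close> subset of the compact space \<open>F\<close>. By
  Baire's theorem, whenever \<open>F\<^sub>t\<close> is a countable union of sets, the closure of one of them
  contains a ball of \<open>F\<close>. Upper box dimension is unchanged by closure and for a ball it is at
  least \<open>dim\<^sub>L F\<close>. Hence even \<open>dim\<^sub>P F\<^sub>t \<ge> dim\<^sub>L F\<close>.
\<close>

section \<open>Subadditivity of the Hausdorff premeasure and a criterion for null sets\<close>

lemma diameter_cball_le: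
  fixes a :: "'a::metric_space"
  assumes "0 \<le> r"
  shows "diameter (cball a r) \<le> 2 * r"
proof -
  have "dist x y \<le> 2 * r" if "x \<in> cball a r" "y \<in> cball a r" for x y
    using that dist_triangle3[of x y a] by auto
  moreover have "cball a r \<noteq> {}"
    using assms by auto
  ultimately show ?thesis
    unfolding diameter_def by (auto intro!: cSUP_least)
qed

lemma premeasure_le_cover:
  assumes "X \<subseteq> (\<Union>i. U i)" "\<And>i::nat. bounded (U i)" "\<And>i. diameter (U i) \<le> \<delta>"
  shows "hausdorff_premeasure s \<delta> X \<le> (\<Sum>i. ennreal (diameter_powr s (U i)))"
  unfolding hausdorff_premeasure_def by (rule INF_lower) (use assms in auto)

lemma premeasure_mono:
  assumes "X \<subseteq> Y"
  shows "hausdorff_premeasure s \<delta> X \<le> hausdorff_premeasure s \<delta> Y"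
  unfolding hausdorff_premeasure_def by (rule INF_superset_mono) (use assms in auto)

lemma premeasure_empty:
  assumes "0 \<le> \<delta>"
  shows "hausdorff_premeasure s \<delta> ({} :: 'a::metric_space set) = 0"
  using premeasure_le_cover[of "{} :: 'a set" "\<lambda>_. {}" \<delta> s] assms by (simp add: diameter_powr_def)

lemma premeasure_le_diameter_powr:
  fixes X :: "'a::metric_space set"
  assumes "0 \<le> \<delta>" "bounded X" "diameter X \<le> \<delta>"
  shows "hausdorff_premeasure s \<delta> X \<le> ennreal (diameter_powr s X)"
proof -
  let ?U = "\<lambda>i::nat. if i = 0 then X else {}"
  have "hausdorff_premeasure s \<delta> X \<le> (\<Sum>i. ennreal (diameter_powr s (?U i)))"
    using assms by (intro premeasure_le_cover) (auto split: if_splits)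
  also have "\<dots> = (\<Sum>i\<in>{0}. ennreal (diameter_powr s (?U i)))"
    by (rule suminf_finite) (auto simp: diameter_powr_def)
  finally show ?thesis by simp
qed

text \<open>Covers of each \<open>X i\<close> that are optimal up to \<open>e / 2^(i+1)\<close> are
  merged into one sequence by the pairing function; the excesses add up to \<open>e\<close>.\<close>

lemma premeasure_UN_le:
  fixes X :: "nat \<Rightarrow> 'a::metric_space set"
  shows "hausdorff_premeasure s \<delta> (\<Union>i. X i) \<le> (\<Sum>i. hausdorff_premeasure s \<delta> (X i))"
proof (rule ennreal_le_epsilon)
  fix e :: real
  assume fin: "(\<Sum>i. hausdorff_premeasure s \<delta> (X i)) < top" and e: "0 < e"
  have "\<exists>U. X i \<subseteq> (\<Union>j. U j) \<and> (\<forall>j::nat. bounded (U j) \<and> diameter (U j) \<le> \<delta>) \<and>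
      (\<Sum>j. ennreal (diameter_powr s (U j)))
        \<le> hausdorff_premeasure s \<delta> (X i) + ennreal (e * (1/2) ^ Suc i)" for i
  proof -
    \<comment> \<open>\<open>ennreal_le_epsilon\<close> permits assuming a finite total, so each
      term is finite and grows strictly when a positive amount is added. The infimum then provides a
      cover.\<close>
    have "hausdorff_premeasure s \<delta> (X i) < top"
      using fin ennreal_suminf_lessD by blast
    then have "hausdorff_premeasure s \<delta> (X i)
        < hausdorff_premeasure s \<delta> (X i) + ennreal (e * (1/2) ^ Suc i)"
      using e by (simp add: ennreal_zero_less_mult_iff)
    then show ?thesis
      by (subst (asm) hausdorff_premeasure_def)
        (auto simp: INF_less_iff intro: less_imp_le)
  qed
  then obtain U where U: "\<And>i. X i \<subseteq> (\<Union>j. U i j)"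
      "\<And>i j::nat. bounded (U i j)" "\<And>i j. diameter (U i j) \<le> \<delta>"
      "\<And>i. (\<Sum>j. ennreal (diameter_powr s (U i j)))
        \<le> hausdorff_premeasure s \<delta> (X i) + ennreal (e * (1/2) ^ Suc i)"
    by metis
  define V where "V = (\<lambda>n. case_prod U (prod_decode n))"
  have "(\<Union>i. X i) \<subseteq> (\<Union>n. V n)"
  proof
    fix x assume "x \<in> (\<Union>i. X i)"
    then obtain i j where "x \<in> U i j"
      using U(1) by blast
    then have "x \<in> V (prod_encode (i, j))"
      by (simp add: V_def)
    then show "x \<in> (\<Union>n. V n)" by blast
  qed
  then have "hausdorff_premeasure s \<delta> (\<Union>i. X i) \<le> (\<Sum>n. ennreal (diameter_powr s (V n)))"
    by (rule premeasure_le_cover) (auto simp: V_def U split: prod.splits)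
  also have "\<dots> = (\<Sum>i. \<Sum>j. ennreal (diameter_powr s (U i j)))"
    using suminf_ennreal_2dimen[of "\<lambda>i. \<Sum>j. ennreal (diameter_powr s (U i j))"
        "\<lambda>p. ennreal (diameter_powr s (case_prod U p))"]
    by (simp add: V_def)
  also have "\<dots> \<le> (\<Sum>i. hausdorff_premeasure s \<delta> (X i) + ennreal (e * (1/2) ^ Suc i))"
    using U(4) by (intro suminf_le) auto
  also have "\<dots> = (\<Sum>i. hausdorff_premeasure s \<delta> (X i)) + (\<Sum>i. ennreal (e * (1/2) ^ Suc i))"
    by (rule suminf_add[symmetric]) auto
  also have "(\<Sum>i. ennreal (e * (1/2) ^ Suc i)) = ennreal e"
    using e sums_mult[OF power_half_series, of e] by (intro suminf_ennreal_eq) auto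
  finally show "hausdorff_premeasure s \<delta> (\<Union>i. X i)
      \<le> (\<Sum>i. hausdorff_premeasure s \<delta> (X i)) + ennreal e" .
qed

text \<open>Padding with \<open>{}\<close> reduces this to the countable case. Since
  \<open>0 \<le> \<delta>\<close>, the empty set is an admissible covering set and costs
  nothing.\<close>

lemma premeasure_finite_UN_le:
  fixes X :: "'b \<Rightarrow> 'a::metric_space set"
  assumes "finite A" "0 \<le> \<delta>"
  shows "hausdorff_premeasure s \<delta> (\<Union>a\<in>A. X a) \<le> (\<Sum>a\<in>A. hausdorff_premeasure s \<delta> (X a))"
proof -
  obtain f where f: "bij_betw f {..<card A} A"
    using ex_bij_betw_nat_finite[OF assms(1)] by (auto simp: atLeast0LessThan)
  let ?Y = "\<lambda>i. if i < card A then X (f i) else {}"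
  have "(\<Union>a\<in>A. X a) = (\<Union>i. ?Y i)"
    using f by (force simp: bij_betw_def split: if_splits)
  then have "hausdorff_premeasure s \<delta> (\<Union>a\<in>A. X a) \<le> (\<Sum>i. hausdorff_premeasure s \<delta> (?Y i))"
    using premeasure_UN_le[of s \<delta> ?Y] by simp
  also have "\<dots> = (\<Sum>i<card A. hausdorff_premeasure s \<delta> (?Y i))"
    using assms(2) by (intro suminf_finite) (auto simp: premeasure_empty)
  also have "\<dots> = (\<Sum>a\<in>A. hausdorff_premeasure s \<delta> (X a))"
    using sum.reindex_bij_betw[OF f, of "\<lambda>a. hausdorff_premeasure s \<delta> (X a)"] by simp
  finally show ?thesis .
qed

lemma hausdorff_measure_UN_eq_0:
  fixes X :: "nat \<Rightarrow> 'a::metric_space set"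
  assumes "\<And>i. hausdorff_measure s (X i) = 0"
  shows "hausdorff_measure s (\<Union>i. X i) = 0"
proof -
  have "hausdorff_premeasure s \<delta> (X i) = 0" if "\<delta> > 0" for \<delta> i
    using assms[of i] that SUP_upper[of \<delta> "{0<..}" "\<lambda>\<delta>. hausdorff_premeasure s \<delta> (X i)"]
    unfolding hausdorff_measure_def by simp
  then have "hausdorff_premeasure s \<delta> (\<Union>i. X i) = 0" if "\<delta> > 0" for \<delta>
    using premeasure_UN_le[of s \<delta> X] that by simp
  then show ?thesis
    unfolding hausdorff_measure_def by (auto intro!: antisym SUP_least)
qed

text \<open>A Borel-Cantelli argument: for every \<open>N\<close> the balls with
  \<open>q \<ge> N\<close> still cover \<open>X\<close>, and their total cost is a tail of a
  convergent series.\<close>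

lemma hausdorff_measure_limsup_eq_0:
  fixes A :: "nat \<Rightarrow> 'a::metric_space set"
  assumes "0 < s" and fin: "\<And>q. finite (A q)" and r0: "\<And>q. 0 \<le> r q" and lim: "r \<longlonglongrightarrow> 0"
    and summ: "summable (\<lambda>q. real (card (A q)) * (2 * r q) powr s)"
    and X: "\<And>x. x \<in> X \<Longrightarrow> \<exists>\<^sub>F q in sequentially. x \<in> (\<Union>a\<in>A q. cball a (r q))"
  shows "hausdorff_measure s X = 0"
proof -
  let ?g = "\<lambda>q. real (card (A q)) * (2 * r q) powr s"
  have "hausdorff_premeasure s \<delta> X = 0" if \<delta>: "\<delta> > 0" for \<delta>
  proof -
    \<comment> \<open>The summand \<open>0\<close> is kept so that \<open>ennreal_le_epsilon\<close>
      applies with bound \<open>0\<close>.\<close>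
    have "hausdorff_premeasure s \<delta> X \<le> 0 + ennreal e" if e: "e > 0" for e
    proof -
      have "\<forall>\<^sub>F q in sequentially. r q < \<delta> / 2"
        using lim \<delta> by (intro order_tendstoD) auto
      moreover have "\<forall>\<^sub>F n in sequentially. (\<Sum>k. ?g (k + n)) < e"
        using suminf_exist_split2[OF summ] e by (intro order_tendstoD) auto
      ultimately have "\<forall>\<^sub>F n in sequentially. (\<forall>q\<ge>n. r q < \<delta> / 2) \<and> (\<Sum>k. ?g (k + n)) < e"
        by (simp add: eventually_all_ge_at_top eventually_conj_iff)
      then obtain N where N: "\<And>q. q \<ge> N \<Longrightarrow> r q < \<delta> / 2" "(\<Sum>k. ?g (k + N)) < e"
        by (auto simp: eventually_sequentially)
      let ?B = "\<lambda>k. \<Union>a\<in>A (k + N). cball a (r (k + N))"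
      have "X \<subseteq> (\<Union>k. ?B k)"
      proof
        fix x assume "x \<in> X"
        then obtain q where "q \<ge> N" "x \<in> (\<Union>a\<in>A q. cball a (r q))"
          using X[of x] unfolding frequently_sequentially by blast
        then show "x \<in> (\<Union>k. ?B k)"
          by (intro UN_I[of "q - N"]) auto
      qed
      then have "hausdorff_premeasure s \<delta> X \<le> (\<Sum>k. hausdorff_premeasure s \<delta> (?B k))"
        by (rule order_trans[OF premeasure_mono premeasure_UN_le])
      also have "\<dots> \<le> (\<Sum>k. ennreal (?g (k + N)))"
      proof (intro suminf_le)
        fix k
        have *: "hausdorff_premeasure s \<delta> (cball a (r (k + N))) \<le> ennreal ((2 * r (k + N)) powr s)"
          for a :: 'a
        proof -
          have d: "diameter (cball a (r (k + N))) \<le> 2 * r (k + N)"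
            by (intro diameter_cball_le r0)
          then have "hausdorff_premeasure s \<delta> (cball a (r (k + N)))
              \<le> ennreal (diameter_powr s (cball a (r (k + N))))"
            using N(1)[of "k + N"] \<delta> by (intro premeasure_le_diameter_powr) auto
          also have "\<dots> \<le> ennreal ((2 * r (k + N)) powr s)"
            using d \<open>0 < s\<close> r0[of "k + N"]
            by (intro ennreal_leI) (auto simp: diameter_powr_def intro!: powr_mono2 diameter_ge_0)
          finally show ?thesis .
        qed
        have "hausdorff_premeasure s \<delta> (?B k)
            \<le> (\<Sum>a\<in>A (k + N). hausdorff_premeasure s \<delta> (cball a (r (k + N))))"
          using fin \<delta> by (intro premeasure_finite_UN_le) auto
        also have "\<dots> \<le> (\<Sum>a\<in>A (k + N). ennreal ((2 * r (k + N)) powr s))"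
          by (intro sum_mono *)
        also have "\<dots> = ennreal (?g (k + N))"
          by (simp add: ennreal_mult ennreal_of_nat_eq_real_of_nat)
        finally show "hausdorff_premeasure s \<delta> (?B k) \<le> ennreal (?g (k + N))" .
      qed auto
      also have "\<dots> = ennreal (\<Sum>k. ?g (k + N))"
        using summ by (intro suminf_ennreal2) (auto simp: summable_iff_shift[of ?g N])
      also have "\<dots> \<le> 0 + ennreal e"
        using N(2) by (simp add: ennreal_leI)
      finally show ?thesis .
    qed
    then show ?thesis
      using ennreal_le_epsilon[of 0 "hausdorff_premeasure s \<delta> X"] by simp
  qed
  then show ?thesis
    unfolding hausdorff_measure_def by (auto intro!: antisym SUP_least)
qed

section \<open>Counting separated sets by the upper box dimension\<close>

lemma log_enat_nonneg: "0 \<le> log_enat n"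
proof (cases n)
  case (enat k)
  then show ?thesis by (cases "k = 0") (auto simp: log_enat_def)
qed (simp add: log_enat_def)

lemma log_enat_mono:
  assumes "m \<le> n"
  shows "log_enat m \<le> log_enat n"
proof (cases m)
  case (enat k)
  show ?thesis
  proof (cases n)
    case (enat l)
    \<comment> \<open>For \<open>k = 0\<close> the claim is only nonnegativity, because
      \<open>ln 0 = 0\<close>.\<close>
    then show ?thesis
      using assms \<open>m = enat k\<close> log_enat_nonneg[of n] by (cases "k = 0") (auto simp: log_enat_def)
  qed (simp add: log_enat_def)
qed (use assms in \<open>simp add: log_enat_def\<close>)

lemma card_le_sep_number:
  assumes "A \<subseteq> X" "finite A" "separated r A"
  shows "enat (card A) \<le> sep_number r X"
  unfolding sep_number_def by (rule SUP_upper) (use assms in auto)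

lemma eventually_at_right_0_lt: "0 < a \<Longrightarrow> \<forall>\<^sub>F r in at_right (0::real). 0 < r \<and> r < a"
  by (auto simp: eventually_at_right_field)

lemma upper_box_dim_nonneg: "0 \<le> upper_box_dim X"
  unfolding upper_box_dim_def
proof (rule le_Limsup)
  show "\<forall>\<^sub>F r in at_right 0. 0 \<le> log_enat (sep_number r X) / ereal (- ln r)"
    using eventually_at_right_0_lt[of 1]
    by (auto elim!: eventually_mono intro!: zero_le_divide_ereal log_enat_nonneg)
qed simp

text \<open>Exponentiates \<open>ln (card A) / (- ln r) < s\<close>. Finiteness is asserted as well,
  since \<open>card\<close> is \<open>0\<close> on infinite sets and the bound alone would say
  nothing about them.\<close>

lemma upper_box_dim_less_imp_card_le:
  assumes "upper_box_dim Y < ereal s"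
  shows "\<forall>\<^sub>F r in at_right 0. \<forall>A\<subseteq>Y. separated r A \<longrightarrow>
    finite A \<and> real (card A) \<le> r powr (- s)"
proof -
  have "\<forall>\<^sub>F r in at_right 0. log_enat (sep_number r Y) / ereal (- ln r) < ereal s"
    using assms unfolding upper_box_dim_def by (rule Limsup_lessD)
  then show ?thesis
    using eventually_at_right_0_lt[OF zero_less_one]
  proof eventually_elim
    case (elim r)
    have bnd: "real (card A) \<le> r powr (- s)" if A: "A \<subseteq> Y" "finite A" "separated r A" for A
    proof (cases "A = {}")
      case False
      have "ereal (ln (real (card A)) / (- ln r)) = log_enat (enat (card A)) / ereal (- ln r)"
        using elim by (simp add: log_enat_def)
      also have "\<dots> \<le> log_enat (sep_number r Y) / ereal (- ln r)"
        using elim by (intro ereal_divide_right_mono log_enat_mono card_le_sep_number A) auto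
      also have "\<dots> < ereal s" using elim by simp
      finally have "ln (real (card A)) / (- ln r) < s" by simp
      then have "ln (real (card A)) \<le> - s * ln r"
        using elim by (simp add: field_simps)
      moreover have "0 < real (card A)"
        using A False by (simp add: card_gt_0_iff)
      ultimately have "real (card A) \<le> exp (- s * ln r)"
        by (metis exp_le_cancel_iff exp_ln)
      then show ?thesis
        using elim by (simp add: powr_def)
    qed auto
    show ?case
    proof (intro allI impI)
      fix A assume A: "A \<subseteq> Y" "separated r A"
      \<comment> \<open>Finite subsets of \<open>A\<close> inherit separation, so their sizes are
        uniformly bounded and \<open>A\<close> cannot be infinite.\<close>
      have "card G \<le> nat \<lfloor>r powr (- s)\<rfloor>" if "G \<subseteq> A" "finite G" for G
        using bnd[of G] A that by (auto simp: separated_def le_nat_floor subset_eq)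
      then have "finite A"
        using finite_if_finite_subsets_card_bdd by blast
      then show "finite A \<and> real (card A) \<le> r powr (- s)"
        using bnd[OF A(1) _ A(2)] by blast
    qed
  qed
qed

text \<open>A separated set of greatest cardinality works: being finite, it would gain an element by
  any extension.\<close>

lemma maximal_separated_exists:
  assumes "\<And>A. A \<subseteq> Y \<Longrightarrow> separated r A \<Longrightarrow> finite A \<and> real (card A) \<le> c"
  shows "\<exists>A. maximal_separated Y r A"
proof -
  let ?P = "\<lambda>A. A \<subseteq> Y \<and> separated r A"
  have "?P {}" by (simp add: separated_def)
  moreover have "\<forall>A. ?P A \<longrightarrow> card A \<le> nat \<lfloor>c\<rfloor>"
    using assms by (auto simp: le_nat_floor)
  ultimately obtain A where A: "?P A" "\<And>B. ?P B \<Longrightarrow> card B \<le> card A"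
    using ex_has_greatest_nat[of ?P "{}" card "Suc (nat \<lfloor>c\<rfloor>)"]
    unfolding less_Suc_eq_le by meson
  have "\<not> separated r (insert x A)" if "x \<in> Y - A" for x
  proof
    assume "separated r (insert x A)"
    then have "card (insert x A) \<le> card A"
      using A that by auto
    then show False
      using assms[of A] A that by auto
  qed
  then show ?thesis
    using A unfolding maximal_separated_def by blast
qed

text \<open>A point of \<open>F\<close> at distance at least \<open>r\<close> from all of
  \<open>A\<close> could be added to \<open>A\<close>.\<close>

lemma maximal_separated_dense:
  assumes "maximal_separated F r A" "x \<in> F" "0 < r"
  shows "\<exists>a\<in>A. dist a x < r"
proof (cases "x \<in> A")
  case False
  then have "\<not> separated r (insert x A)" "separated r A"
    using assms by (auto simp: maximal_separated_def)
  then obtain a where "a \<in> A" "dist a x < r \<or> dist x a < r"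
    unfolding separated_def by (metis insert_iff not_le)
  then show ?thesis
    by (auto simp: dist_commute)
next
  case True
  then show ?thesis
    using assms(3) by (intro bexI[of _ x]) auto
qed

section \<open>The upper bound for the Hausdorff dimension\<close>

text \<open>Supplies the covers for the Borel-Cantelli argument. The scale
  \<open>1 / (2 * real q)\<close> is fine enough for both cases of \<open>t\<close>, which therefore
  share one bound.\<close>

lemma approximation_balls_cover:
  fixes F :: "'a::metric_space set"
  assumes P: "abstract_rationals F P" and Y: "upper_box_dim Y < ereal s" and t: "1 \<le> t"
  shows "\<forall>\<^sub>F q in sequentially. \<exists>A. finite A \<and> real (card A) \<le> (2 * real q) powr s \<and>
    Y \<inter> (\<Union>p\<in>P q. cball p (1 / real q powr t)) \<subseteq> (\<Union>a\<in>A. cball a (1 / real q powr t))"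
proof -
  have lim: "filterlim (\<lambda>q. 1 / (2 * real q)) (at_right 0) sequentially"
    by real_asymp
  \<comment> \<open>The factor \<open>4\<close> makes the radius at most a quarter of the separation
    \<open>1 / real q\<close>. The implication form lets both cases of \<open>t\<close> use the same
    large \<open>q\<close>.\<close>
  have "\<forall>\<^sub>F q in sequentially. t > 1 \<longrightarrow> 4 \<le> real q powr (t - 1)"
  proof (cases "t > 1")
    case True
    then have "filterlim (\<lambda>q. real q powr (t - 1)) at_top sequentially"
      by real_asymp
    then show ?thesis
      by (auto simp: filterlim_at_top elim: eventually_mono)
  qed auto
  then show ?thesis
    using eventually_compose_filterlim[OF upper_box_dim_less_imp_card_le[OF Y] lim]
      eventually_gt_at_top[of 0]
  proof eventually_elim
    case (elim q)
    then have q: "real q > 0" by simp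
    have pw: "(1 / (2 * real q)) powr (- s) = (2 * real q) powr s"
      using q by (simp add: powr_divide powr_minus_divide)
    have card: "finite A \<and> real (card A) \<le> (2 * real q) powr s"
      if "A \<subseteq> Y" "separated (1 / (2 * real q)) A" for A
      using elim(2) that pw by auto
    show ?case
    \<comment> \<open>For \<open>t = 1\<close> the radius equals the separation, so points of \<open>Y\<close> chosen in different balls
      need not be separated; a net of \<open>Y\<close> itself is used instead.\<close>
    proof (cases "t = 1")
      case True
      have card': "finite A \<and> real (card A) \<le> (2 * real q) powr s"
        if "A \<subseteq> Y" "separated (1 / real q) A" for A
      proof (rule card[OF that(1)])
        have "1 / (2 * real q) \<le> 1 / real q"
          using q by (simp add: field_simps)
        then show "separated (1 / (2 * real q)) A"
          using that(2) unfolding separated_def by (meson order_trans)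
      qed
      then obtain A where A: "maximal_separated Y (1 / real q) A"
        using maximal_separated_exists by blast
      \<comment> \<open>Here the radius is \<open>1 / real q\<close>, so the net covers all of
        \<open>Y\<close>.\<close>
      have "Y \<subseteq> (\<Union>a\<in>A. cball a (1 / real q powr t))"
      proof
        fix y assume "y \<in> Y"
        then obtain a where "a \<in> A" "dist a y < 1 / real q"
          using maximal_separated_dense[OF A] q by (meson divide_pos_pos zero_less_one)
        then show "y \<in> (\<Union>a\<in>A. cball a (1 / real q powr t))"
          using q True by force
      qed
      then show ?thesis
        using A card'[of A] unfolding maximal_separated_def by blast
    next
      case False
      let ?\<rho> = "1 / real q powr t"
      define A where "A = {p \<in> P q. cball p ?\<rho> \<inter> Y \<noteq> {}}"
      \<comment> \<open>The centres may lie outside \<open>Y\<close>, where its box dimension counts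
        nothing, so each is moved to a point of \<open>Y\<close> in its ball.\<close>
      have "\<forall>p\<in>A. \<exists>y. y \<in> cball p ?\<rho> \<inter> Y"
        unfolding A_def by blast
      then obtain f where f: "\<And>p. p \<in> A \<Longrightarrow> f p \<in> cball p ?\<rho> \<inter> Y"
        by metis
      have "4 \<le> real q powr t / real q"
        using elim False t q by (simp add: powr_diff)
      then have rho: "4 * ?\<rho> \<le> 1 / real q"
        using q by (simp add: field_simps)
      \<comment> \<open>Moving two centres by at most \<open>1 / (4 * real q)\<close> each takes at
        most half of their distance bound \<open>1 / real q\<close>.\<close>
      have sep: "1 / (2 * real q) \<le> dist (f a) (f b)" if "a \<in> A" "b \<in> A" "a \<noteq> b" for a b
      proof -
        have "1 / real q \<le> dist a b"
          using P that elim unfolding A_def abstract_rationals_def maximal_separated_def separated_def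
          by auto
        moreover have "dist a b \<le> dist a (f a) + dist (f a) (f b) + dist b (f b)"
          using dist_triangle[of a b "f a"] dist_triangle[of "f a" b "f b"] by (simp add: dist_commute)
        moreover have "dist a (f a) \<le> ?\<rho>" "dist b (f b) \<le> ?\<rho>"
          using f that by auto
        moreover have "1 / (2 * real q) = (1 / real q) / 2"
          by simp
        ultimately show ?thesis using rho by linarith
      qed
      have inj: "inj_on f A"
      proof (rule inj_onI, rule ccontr)
        fix a b assume "a \<in> A" "b \<in> A" "f a = f b" "a \<noteq> b"
        then show False using sep[of a b] q by simp
      qed
      have "finite (f ` A) \<and> real (card (f ` A)) \<le> (2 * real q) powr s"
        using f sep by (intro card) (auto simp: separated_def)
      then have "finite A \<and> real (card A) \<le> (2 * real q) powr s"
        using inj by (simp add: card_image finite_image_iff)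
      moreover have "Y \<inter> (\<Union>p\<in>P q. cball p ?\<rho>) \<subseteq> (\<Union>a\<in>A. cball a ?\<rho>)"
        unfolding A_def by blast
      ultimately show ?thesis by blast
    qed
  qed
qed

text \<open>The cover at stage \<open>q\<close> costs at most a constant times
  \<open>real q powr (s - t * u)\<close>, which is summable because the exponent is below
  \<open>-1\<close>.\<close>

lemma hausdorff_measure_approximable_piece:
  fixes F :: "'a::metric_space set"
  assumes P: "abstract_rationals F P" and Y: "upper_box_dim Y < ereal s" and t: "1 \<le> t"
    and u: "s + 1 < t * u"
  shows "hausdorff_measure u (approximable F P t \<inter> Y) = 0"
proof -
  let ?r = "\<lambda>q. 1 / real q powr t"
  let ?Q = "\<lambda>q A. finite A \<and> real (card A) \<le> (2 * real q) powr s \<and>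
    Y \<inter> (\<Union>p\<in>P q. cball p (?r q)) \<subseteq> (\<Union>a\<in>A. cball a (?r q))"
  \<comment> \<open>Box dimensions are nonnegative, so \<open>s > 0\<close>. This forces
    \<open>u > 0\<close>, as the null set criterion requires.\<close>
  have s: "0 < s"
    using upper_box_dim_nonneg[of Y] Y by (metis ereal_less(2) le_less_trans)
  then have "0 < t * u" using u by linarith
  then have upos: "0 < u" using t by (simp add: zero_less_mult_iff)
  obtain N where N: "\<And>q. q \<ge> N \<Longrightarrow> \<exists>A. ?Q q A"
    using approximation_balls_cover[OF P Y t] by (auto simp: eventually_sequentially)
  \<comment> \<open>Empty covers for \<open>q < N\<close> do no harm, as only infinitely many large
    \<open>q\<close> matter.\<close>
  define A where "A = (\<lambda>q. if q \<ge> N then SOME A. ?Q q A else {})"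
  have A: "?Q q (A q)" if "q \<ge> N" for q
    using someI_ex[OF N[OF that]] that by (simp add: A_def)
  show ?thesis
  proof (rule hausdorff_measure_limsup_eq_0[of u A ?r])
    show "finite (A q)" for q
      using A[of q] by (cases "q \<ge> N") (auto simp: A_def)
    show "?r \<longlonglongrightarrow> 0"
      using t by real_asymp
    have "summable (\<lambda>q. 2 powr s * 2 powr u * real q powr (s - t * u))"
      using u by (intro summable_mult) (simp add: summable_real_powr_iff)
    then show "summable (\<lambda>q. real (card (A q)) * (2 * ?r q) powr u)"
    proof (rule summable_comparison_test_ev[rotated])
      show "\<forall>\<^sub>F q in sequentially. norm (real (card (A q)) * (2 * ?r q) powr u)
          \<le> 2 powr s * 2 powr u * real q powr (s - t * u)"
        using eventually_ge_at_top[of N] eventually_gt_at_top[of 0]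
      proof eventually_elim
        case (elim q)
        have "real (card (A q)) * (2 * ?r q) powr u \<le> (2 * real q) powr s * (2 * ?r q) powr u"
          using A[OF elim(1)] by (intro mult_right_mono) auto
        also have "\<dots> = 2 powr s * 2 powr u * real q powr (s - t * u)"
          using elim by (simp add: powr_mult powr_divide powr_powr powr_diff)
        finally show ?case by simp
      qed
    qed
    fix x assume x: "x \<in> approximable F P t \<inter> Y"
    show "\<exists>\<^sub>F q in sequentially. x \<in> (\<Union>a\<in>A q. cball a (?r q))"
      unfolding frequently_sequentially
    proof
      fix M
      have "x \<in> (\<Union>q\<in>{max M N<..}. \<Union>p\<in>P q. cball p (?r q) \<inter> F)"
        using x unfolding approximable_def by blast
      then obtain q where q: "q > max M N" "x \<in> (\<Union>p\<in>P q. cball p (?r q))"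
        by blast
      then have "x \<in> (\<Union>a\<in>A q. cball a (?r q))"
        using A[of q] x by (meson IntD2 IntI less_imp_le max.strict_boundedE subsetD)
      then show "\<exists>q\<ge>M. x \<in> (\<Union>a\<in>A q. cball a (?r q))"
        using q by (intro exI[of _ q]) auto
    qed
  qed (use upos in auto)
qed

lemma packing_dim_nonneg: "0 \<le> packing_dim X"
  unfolding packing_dim_def
  by (rule INF_greatest) (meson SUP_upper2 UNIV_I upper_box_dim_nonneg)

text \<open>Null sets are stable under countable unions, so the pieces of a decomposition of
  \<open>F\<close> are treated separately, for each \<open>u\<close> above the claimed
  bound.\<close>

lemma hausdorff_dim_approximable_le:
  fixes F :: "'a::metric_space set"
  assumes P: "abstract_rationals F P" and t: "1 \<le> t"
  shows "hausdorff_dim (approximable F P t) \<le> (packing_dim F + 1) / ereal t"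
proof (cases "packing_dim F")
  case (real d)
  have "hausdorff_dim (approximable F P t) \<le> ereal u" if u: "(d + 1) / t < u" for u
  proof -
    have d: "0 \<le> d" using packing_dim_nonneg[of F] real by simp
    have "d + 1 < t * u" using u t by (simp add: field_simps)
    \<comment> \<open>The slack in \<open>u\<close> leaves room for some \<open>s\<close> strictly
      between \<open>d\<close> and \<open>t * u - 1\<close>.\<close>
    then obtain s where s: "d < s" "s + 1 < t * u"
      using dense[of d "t * u - 1"] by auto
    have "packing_dim F < ereal s" using real s by simp
    then obtain Y :: "nat \<Rightarrow> 'a set" where Y: "(\<Union>i. Y i) = F" "(SUP i. upper_box_dim (Y i)) < ereal s"
      unfolding packing_dim_def by (auto simp: INF_less_iff)
    have "hausdorff_measure u (approximable F P t \<inter> Y i) = 0" for i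
    proof (rule hausdorff_measure_approximable_piece[OF P _ t s(2)])
      show "upper_box_dim (Y i) < ereal s"
        using Y(2) by (meson SUP_upper UNIV_I le_less_trans)
    qed
    then have "hausdorff_measure u (\<Union>i. approximable F P t \<inter> Y i) = 0"
      by (rule hausdorff_measure_UN_eq_0)
    moreover have "approximable F P t \<subseteq> F"
      unfolding approximable_def by blast
    then have "(\<Union>i. approximable F P t \<inter> Y i) = approximable F P t"
      using Y(1) by blast
    moreover have "0 \<le> u"
      using u d t by (smt (verit) divide_nonneg_pos)
    ultimately show ?thesis
      unfolding hausdorff_dim_def by (intro Inf_lower) auto
  qed
  then have "hausdorff_dim (approximable F P t) \<le> ereal ((d + 1) / t) + ereal e" if "e > 0" for e
    using that by (metis less_add_same_cancel1 plus_ereal.simps(1))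
  then have "hausdorff_dim (approximable F P t) \<le> ereal ((d + 1) / t)"
    by (blast intro: ereal_le_epsilon2)
  then show ?thesis
    using real t by (simp add: one_ereal_def)
\<comment> \<open>The value \<open>\<infinity>\<close> makes the bound trivial, and
  \<open>-\<infinity>\<close> is excluded by nonnegativity.\<close>
qed (use packing_dim_nonneg[of F] t in auto)

section \<open>Bounding the upper box dimension from below\<close>

text \<open>Moving each point by less than \<open>r / 4\<close> into \<open>Y\<close> reduces mutual
  distances by less than \<open>r / 2\<close>.\<close>

lemma sep_number_closure_le:
  assumes "0 < r" "Z \<subseteq> closure Y"
  shows "sep_number r Z \<le> sep_number (r / 2) Y"
  unfolding sep_number_def[of r]
proof (rule SUP_least)
  fix A assume "A \<in> {A. A \<subseteq> Z \<and> finite A \<and> separated r A}"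
  then have A: "A \<subseteq> Z" "finite A" "separated r A" by auto
  have "\<exists>y\<in>Y. dist y a < r / 4" if "a \<in> A" for a
  proof -
    have "a \<in> closure Y" "0 < r / 4" using that A(1) assms by auto
    then show ?thesis unfolding closure_approachable by blast
  qed
  then obtain f where f: "\<And>a. a \<in> A \<Longrightarrow> f a \<in> Y \<and> dist (f a) a < r / 4"
    by metis
  have sep: "r / 2 \<le> dist (f a) (f b)" if "a \<in> A" "b \<in> A" "a \<noteq> b" for a b
  proof -
    have "r \<le> dist a b" using A that by (auto simp: separated_def)
    moreover have "dist a b \<le> dist (f a) a + dist (f a) (f b) + dist (f b) b"
      using dist_triangle[of a b "f a"] dist_triangle[of "f a" b "f b"] by (simp add: dist_commute)
    ultimately show ?thesis using f[OF that(1)] f[OF that(2)] by linarith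
  qed
  have "inj_on f A"
    using sep assms by (intro inj_onI) (metis dist_self half_gt_zero not_le)
  then have "enat (card A) = enat (card (f ` A))"
    by (simp add: card_image)
  also have "\<dots> \<le> sep_number (r / 2) Y"
  proof (rule card_le_sep_number)
    show "separated (r / 2) (f ` A)"
      unfolding separated_def using sep by (metis imageE)
  qed (use A f in auto)
  finally show "enat (card A) \<le> sep_number (r / 2) Y" .
qed

text \<open>The constant is irrelevant in the limit, because \<open>ln c / (- ln r)\<close> tends to
  \<open>0\<close>.\<close>

lemma upper_box_dim_ge:
  assumes "0 < c" "\<forall>\<^sub>F r in at_right 0. ereal (c * r powr (- s)) \<le> ereal_of_enat (sep_number r Y)"
  shows "ereal s \<le> upper_box_dim Y"
proof -
  let ?f = "\<lambda>r. ereal ((ln c - s * ln r) / (- ln r))"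
  have "((\<lambda>r. (ln c - s * ln r) / (- ln r)) \<longlongrightarrow> s) (at_right 0)"
    by real_asymp
  then have "Limsup (at_right 0) ?f = ereal s"
    by (intro lim_imp_Limsup) (auto intro: tendsto_intros)
  moreover have "Limsup (at_right 0) ?f \<le> upper_box_dim Y"
    unfolding upper_box_dim_def
  proof (rule Limsup_mono)
    show "\<forall>\<^sub>F r in at_right 0. ?f r \<le> log_enat (sep_number r Y) / ereal (- ln r)"
      using assms(2) eventually_at_right_0_lt[OF zero_less_one]
    proof eventually_elim
      case (elim r)
      have eq: "ln c - s * ln r = ln (c * r powr (- s))"
        using assms(1) elim by (simp add: ln_mult)
      have "ereal (ln c - s * ln r) \<le> log_enat (sep_number r Y)"
      proof (cases "sep_number r Y")
        case (enat n)
        then have "c * r powr (- s) \<le> real n" using elim by simp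
        moreover have "0 < c * r powr (- s)" using assms(1) elim by simp
        ultimately show ?thesis
          unfolding eq enat by (simp add: log_enat_def)
      qed (simp add: log_enat_def)
      then have "ereal (ln c - s * ln r) / ereal (- ln r)
          \<le> log_enat (sep_number r Y) / ereal (- ln r)"
        using elim by (intro ereal_divide_right_mono) auto
      then show ?case using elim by simp
    qed
  qed
  ultimately show ?thesis by simp
qed

text \<open>The lower dimension condition is used at the single point \<open>x\<close> and one fixed
  large radius, while the small radius tends to \<open>0\<close>.\<close>

lemma lower_dim_le_upper_box_dim:
  fixes F :: "'a::metric_space set"
  assumes F: "bounded F" and x: "x \<in> F" and R: "0 < R" "cball x R \<inter> F \<subseteq> closure Y"
  shows "lower_dim F \<le> upper_box_dim Y"
proof (cases "\<exists>a. F \<subseteq> {a}")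
  case True
  then show ?thesis by (simp add: lower_dim_def upper_box_dim_nonneg)
next
  case False
  then obtain y where "y \<in> F" "y \<noteq> x" by blast
  then have diam: "0 < diameter F"
    using diameter_bounded_bound[OF F x, of y] by (smt (verit) zero_less_dist_iff)
  \<comment> \<open>The lower dimension condition only speaks of radii up to the diameter.\<close>
  define R' where "R' = min R (diameter F)"
  have R': "0 < R'" "R' \<le> diameter F" "cball x R' \<inter> F \<subseteq> closure Y"
    using R diam by (auto simp: R'_def)
  have "ereal s \<le> upper_box_dim Y"
    if "C > 0" and C: "\<And>r R. 0 < r \<Longrightarrow> r < R \<Longrightarrow> R \<le> diameter F \<Longrightarrow>
        ereal (C * (R / r) powr s) \<le> ereal_of_enat (sep_number r (cball x R \<inter> F))" for s C
  proof (rule upper_box_dim_ge)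
    show "0 < C * (R' / 2) powr s" using \<open>C > 0\<close> R' by simp
    show "\<forall>\<^sub>F r in at_right 0. ereal (C * (R' / 2) powr s * r powr (- s))
        \<le> ereal_of_enat (sep_number r Y)"
      using eventually_at_right_0_lt[OF half_gt_zero[OF R'(1)]]
    proof eventually_elim
      case 2: (elim r)
      \<comment> \<open>Passing from the closure to \<open>Y\<close> halves the scale, so the count
        is made at \<open>2 * r\<close>; hence the \<open>R' / 2\<close> in the constant.\<close>
      have "C * (R' / 2) powr s * r powr (- s) = C * (R' / (2 * r)) powr s"
        using 2 R' by (simp add: powr_divide powr_mult powr_minus_divide)
      also have "ereal \<dots> \<le> ereal_of_enat (sep_number (2 * r) (cball x R' \<inter> F))"
        using 2 R' by (intro C) auto
      also have "\<dots> \<le> ereal_of_enat (sep_number r Y)"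
        using sep_number_closure_le[OF _ R'(3), of "2 * r"] 2 by simp
      finally show ?case .
    qed
  qed
  then show ?thesis
    using False F x unfolding lower_dim_def by (auto intro!: Sup_least)
qed

section \<open>Baire category and the lower bound for the packing dimension\<close>

text \<open>If no closure contained a ball, the traces on \<open>F\<close> of these closures and of
  the complements of the \<open>G n\<close> would be countably many nowhere dense closed sets
  covering \<open>F\<close>.\<close>

lemma Baire_closure_contains_ball:
  fixes F :: "'a::metric_space set" and Y :: "nat \<Rightarrow> 'a set"
  assumes F: "compact F" "F \<noteq> {}"
    and G: "\<And>n::nat. open (G n)" "\<And>n. F \<subseteq> closure (F \<inter> G n)" "F \<inter> (\<Inter>n. G n) \<subseteq> (\<Union>i. Y i)"
  shows "\<exists>i. \<exists>x\<in>F. \<exists>R>0. cball x R \<inter> F \<subseteq> closure (Y i)"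
proof (rule ccontr)
  assume no: "\<not> ?thesis"
  let ?X = "top_of_set F"
  let ?\<G> = "range (\<lambda>i. F \<inter> closure (Y i)) \<union> range (\<lambda>n. F - G n)"
  have "?X interior_of \<Union>?\<G> = {}"
  proof (rule Baire_category_alt)
    have "compact_space ?X" "Hausdorff_space ?X"
      using F by (auto simp: compact_space_subtopology Hausdorff_space_subtopology)
    then show "completely_metrizable_space ?X \<or> locally_compact_space ?X \<and> regular_space ?X"
      by (simp add: compact_imp_locally_compact_space compact_Hausdorff_imp_regular_space)
    fix T assume "T \<in> ?\<G>"
    then consider i where "T = F \<inter> closure (Y i)" | n where "T = F - G n" by blast
    then show "closedin ?X T \<and> ?X interior_of T = {}"
    proof cases
      case 1
      have "?X interior_of T = {}"
      proof (rule ccontr)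
        assume "?X interior_of T \<noteq> {}"
        then obtain x V where V: "x \<in> F" "open V" "x \<in> V" "F \<inter> V \<subseteq> T"
          by (auto simp: interior_of_def openin_open)
        then obtain R where "R > 0" "cball x R \<subseteq> V"
          using open_contains_cball by blast
        then show False
          using no V 1 by blast
      qed
      then show ?thesis using 1 by (auto simp: closedin_closed)
    next
      case 2
      have "?X interior_of T = {}"
      proof (rule ccontr)
        assume "?X interior_of T \<noteq> {}"
        then obtain x V where V: "x \<in> F" "open V" "x \<in> V" "F \<inter> V \<subseteq> T"
          by (auto simp: interior_of_def openin_open)
        then have "V \<inter> (F \<inter> G n) \<noteq> {}"
          using G(2)[of n] open_Int_closure_eq_empty[OF V(2), of "F \<inter> G n"] by blast
        then show False using V 2 by blast
      qed
      moreover have "T = F \<inter> - G n" using 2 by blast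
      ultimately show ?thesis using G(1)[of n] by (auto simp: closedin_closed)
    qed
  qed auto
  moreover have "\<Union>?\<G> = F"
  proof
    show "F \<subseteq> \<Union>?\<G>"
    proof
      fix x assume "x \<in> F"
      then show "x \<in> \<Union>?\<G>"
      proof (cases "x \<in> (\<Inter>n. G n)")
        case True
        then obtain i where "x \<in> Y i" using G(3) \<open>x \<in> F\<close> by blast
        then have "x \<in> F \<inter> closure (Y i)" using closure_subset \<open>x \<in> F\<close> by blast
        then show ?thesis by blast
      qed blast
    qed
  qed auto
  ultimately show False
    using F interior_of_topspace[of ?X] by simp
qed

text \<open>The union of \<open>P q\<close> over \<open>q > n\<close> is dense in \<open>F\<close>
  for every \<open>n\<close>, which gives a dense countable intersection of relatively open sets
  inside \<open>approximable F P t\<close>.\<close>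

lemma lower_dim_le_packing_dim_approximable:
  fixes F :: "'a::metric_space set"
  assumes F: "compact F" "F \<noteq> {}" and P: "abstract_rationals F P"
  shows "lower_dim F \<le> packing_dim (approximable F P t)"
  unfolding packing_dim_def
proof (rule INF_greatest)
  fix Y :: "nat \<Rightarrow> 'a set"
  assume "Y \<in> {Y. (\<Union>i. Y i) = approximable F P t}"
  then have Y: "(\<Union>i. Y i) = approximable F P t" by simp
  \<comment> \<open>Open balls replace the closed ones of \<open>approximable\<close> so that
    Baire's theorem applies.\<close>
  let ?G = "\<lambda>n. \<Union>q\<in>{n<..}. \<Union>p\<in>P q. ball p (1 / real q powr t)"
  have "\<exists>i. \<exists>x\<in>F. \<exists>R>0. cball x R \<inter> F \<subseteq> closure (Y i)"
  proof (rule Baire_closure_contains_ball[OF F])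
    show "open (?G n)" for n by blast
    have "F \<inter> ?G n \<subseteq> (\<Union>q\<in>{n<..}. \<Union>p\<in>P q. cball p (1 / real q powr t) \<inter> F)" for n
      using ball_subset_cball by blast
    moreover have "F \<inter> (\<Inter>n. ?G n) \<subseteq> F \<inter> ?G n" for n
      by blast
    ultimately show "F \<inter> (\<Inter>n. ?G n) \<subseteq> (\<Union>i. Y i)"
      unfolding Y approximable_def by (intro INT_greatest) (rule order_trans)
    show "F \<subseteq> closure (F \<inter> ?G n)" for n
    proof
      fix x assume x: "x \<in> F"
      show "x \<in> closure (F \<inter> ?G n)"
        unfolding closure_approachable
      proof (intro allI impI)
        fix e :: real assume "0 < e"
        then obtain k where k: "1 / real (Suc k) < e"
          using nat_approx_posE by blast
        \<comment> \<open>The successor of the maximum gives \<open>q > n\<close> and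
          \<open>q \<ge> Suc k\<close> together.\<close>
        define q where "q = Suc (max n k)"
        have q: "n < q" "0 < q" "1 / real q < e"
        proof -
          have "1 / real q \<le> 1 / real (Suc k)" by (simp add: q_def field_simps)
          then show "1 / real q < e" using k by linarith
        qed (auto simp: q_def)
        have max: "maximal_separated F (1 / real q) (P q)"
          using P q by (simp add: abstract_rationals_def)
        then obtain p where p: "p \<in> P q" "dist p x < 1 / real q"
          using maximal_separated_dense[OF max x] q by auto
        moreover have "p \<in> F" using max p by (auto simp: maximal_separated_def)
        moreover have "p \<in> ?G n"
        proof (intro UN_I)
          show "q \<in> {n<..}" "p \<in> P q" "p \<in> ball p (1 / real q powr t)"
            using q p by auto
        qed
        ultimately show "\<exists>y\<in>F \<inter> ?G n. dist y x < e"
          using q by (intro bexI[of _ p]) auto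
      qed
    qed
  qed
  then obtain i x R where "x \<in> F" "0 < R" "cball x R \<inter> F \<subseteq> closure (Y i)"
    by blast
  then have "lower_dim F \<le> upper_box_dim (Y i)"
    by (rule lower_dim_le_upper_box_dim[OF compact_imp_bounded[OF F(1)]])
  also have "\<dots> \<le> (SUP i. upper_box_dim (Y i))"
    by (rule SUP_upper) simp
  finally show "lower_dim F \<le> (SUP i. upper_box_dim (Y i))" .
qed

theorem theorem2p1:
  fixes F :: "'a::metric_space set" and P :: "nat \<Rightarrow> 'a set"
  assumes "F \<noteq> {}" and "totally_bounded F" and "abstract_rationals F P"
  shows "(\<forall>t::real. 1 \<le> t \<longrightarrow>
            hausdorff_dim (approximable F P t) \<le> (packing_dim F + 1) / ereal t)
       \<and> (compact F \<longrightarrow> (\<forall>t::real. 1 \<le> t \<longrightarrow>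
            lower_dim F / ereal t \<le> packing_dim (approximable F P t)))"
proof (intro conjI allI impI)
  fix t :: real assume t: "1 \<le> t"
  then show "hausdorff_dim (approximable F P t) \<le> (packing_dim F + 1) / ereal t"
    by (rule hausdorff_dim_approximable_le[OF assms(3)])
  assume "compact F"
  let ?p = "packing_dim (approximable F P t)"
  have "lower_dim F / ereal t \<le> ?p / ereal t"
    using lower_dim_le_packing_dim_approximable[OF \<open>compact F\<close> assms(1,3)] t
    by (intro ereal_divide_right_mono) auto
  \<comment> \<open>Dividing a nonnegative value by \<open>t \<ge> 1\<close> cannot increase it, so
    the undivided bound suffices.\<close>
  also have "\<dots> \<le> ?p"
    using packing_dim_nonneg[of "approximable F P t"] t
    by (cases ?p) (auto simp: divide_le_eq mult_le_cancel_left1)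
  finally show "lower_dim F / ereal t \<le> ?p" .
qed

end
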